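(* Let $(A,\mu,\Delta=[-,r],r)$ be a coboundary $\epsilon$-bialgebra and $\alpha\colon A\to A$ be an algebra morphism such that $\alpha^{\otimes 2}(r)=r$. Then $$A_\alpha=(A,\mu_\alpha,\Delta_\alpha,\alpha,r)$$ is a coboundary $\epsilon$-Hom-bialgebra, where $\mu_\alpha=\alpha\circ\mu$ and $\Delta_\alpha=\Delta\circ\alpha$.
   Context: Throughout, $\mathbf{k}$ is a fixed field of characteristic $0$; vector spaces, linear maps and tensor products are over $\mathbf{k}$. Algebras are not required to be unital; an algebra morphism is a linear map commuting with the multiplications. An $\epsilon$-Hom-bialgebra $(A,\mu,\Delta,\alpha)$ is a $\mathbf{k}$-vector space $A$ with linear maps $\mu\colon A^{\otimes 2}\to A$, $\Delta\colon A\to A^{\otimes 2}$, $\alpha\colon A\to A$ such that: $\alpha\circ\mu=\mu\circ\alpha^{\otimes 2}$; $\mu\circ(\alpha\otimes\mu)=\mu\circ(\mu\otimes\alpha)$; $\alpha^{\otimes 2}\circ\Delta=\Delta\circ\alpha$; $(\alpha\otimes\Delta)\circ\Delta=(\Delta\otimes\alpha)\circ\Delta$; and $\Delta\circ\mu=(\mu\otimes\alpha)\circ(\alpha\otimes\Delta)+(\alpha\otimes\mu)\circ(\Delta\otimes\alpha)$. An $\epsilon$-bialgebra is an $\epsilon$-Hom-bialgebra with $\alpha=Id$. For $a\in A$ and $r=\sum u_i\otimes v_i\in A^{\otimes 2}$, set (relative to $\mu$ and $\alpha$) $$[a,r]_*=\sum\mu(a,u_i)\otimes\alpha(v_i)-\alpha(u_i)\otimes\mu(v_i,a).$$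 An element of $A^{\otimes 2}$ is $\alpha$-invariant if it is fixed by $\alpha^{\otimes 2}$. A coboundary $\epsilon$-Hom-bialgebra $(A,\mu,\Delta,\alpha,r)$ is an $\epsilon$-Hom-bialgebra $(A,\mu,\Delta,\alpha)$ together with an $\alpha$-invariant $r\in A^{\otimes 2}$ such that $\Delta=[-,r]_*$. A coboundary $\epsilon$-bialgebra $(A,\mu,\Delta,r)$ is a coboundary $\epsilon$-Hom-bialgebra with $\alpha=Id$, i.e. an $\epsilon$-bialgebra with $\Delta(a)=[a,r]=\sum au_i\otimes v_i-u_i\otimes v_ia$ for all $a\in A$. *)

theory Defs
  imports "HOL-Algebra.Module" "HOL-Algebra.AbelCoset"
begin

section \<open>Vector spaces and linear maps\<close>

locale vector_space_char_0 = field K + module K V for K (structure) and V (structure) +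
  assumes char_0: "\<And>n::nat. n > 0 \<Longrightarrow> [n] \<cdot> \<one> \<noteq> \<zero>"

text \<open>Maps are only looked at on carriers: two linear maps count as the same map if they agree on
  the carrier of their domain.\<close>

definition linear_maps ::
    "('k, 'm) ring_scheme \<Rightarrow> ('k, 'a, 'p) module_scheme \<Rightarrow> ('k, 'b, 'q) module_scheme \<Rightarrow> ('a \<Rightarrow> 'b) set"
  where "linear_maps K M N =
    {f. f \<in> carrier M \<rightarrow> carrier N \<and>
        (\<forall>x\<in>carrier M. \<forall>y\<in>carrier M. f (x \<oplus>\<^bsub>M\<^esub> y) = f x \<oplus>\<^bsub>N\<^esub> f y) \<and>
        (\<forall>c\<in>carrier K. \<forall>x\<in>carrier M. f (c \<odot>\<^bsub>M\<^esub> x) = c \<odot>\<^bsub>N\<^esub> f x)}"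

section \<open>Tensor products\<close>

text \<open>The fields \<open>mult\<close> and \<open>one\<close> of a record of type \<open>module\<close> play no role for modules; they get
  dummy values below.\<close>

definition free_module :: "('k, 'm) ring_scheme \<Rightarrow> 'x set \<Rightarrow> ('k, 'x \<Rightarrow> 'k) module"
  where "free_module K S =
    \<lparr>carrier = {f. (\<forall>x. f x \<in> carrier K) \<and> (\<forall>x. x \<notin> S \<longrightarrow> f x = \<zero>\<^bsub>K\<^esub>) \<and> finite {x. f x \<noteq> \<zero>\<^bsub>K\<^esub>}},
     mult = (\<lambda>f g x. \<zero>\<^bsub>K\<^esub>), one = (\<lambda>x. \<zero>\<^bsub>K\<^esub>),
     zero = (\<lambda>x. \<zero>\<^bsub>K\<^esub>), add = (\<lambda>f g x. f x \<oplus>\<^bsub>K\<^esub> g x),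
     smult = (\<lambda>c f x. c \<otimes>\<^bsub>K\<^esub> f x)\<rparr>"

definition free_gen :: "('k, 'm) ring_scheme \<Rightarrow> 'x \<Rightarrow> 'x \<Rightarrow> 'k"
  where "free_gen K s = (\<lambda>x. if x = s then \<one>\<^bsub>K\<^esub> else \<zero>\<^bsub>K\<^esub>)"

definition submodule_generated ::
    "('k, 'm) ring_scheme \<Rightarrow> ('k, 'a, 'p) module_scheme \<Rightarrow> 'a set \<Rightarrow> 'a set"
  where "submodule_generated K M R = \<Inter>{H. submodule H K M \<and> R \<subseteq> H}"

text \<open>In a scalar multiple of a coset \<open>X\<close> the submodule is added again, so that also the zero multiple
  is a full coset.\<close>

definition quotient_module ::
    "('k, 'a, 'p) module_scheme \<Rightarrow> 'a set \<Rightarrow> ('k, 'a set) module"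
  where "quotient_module M H =
    \<lparr>carrier = a_rcosets\<^bsub>M\<^esub> H,
     mult = (\<lambda>X Y. H), one = H,
     zero = H, add = (\<lambda>X Y. X <+>\<^bsub>M\<^esub> Y),
     smult = (\<lambda>c X. \<Union>x\<in>X. H +>\<^bsub>M\<^esub> (c \<odot>\<^bsub>M\<^esub> x))\<rparr>"

definition bilinear_relations ::
    "('k, 'm) ring_scheme \<Rightarrow> ('k, 'a, 'p) module_scheme \<Rightarrow> ('k, 'b, 'q) module_scheme \<Rightarrow> ('a \<times> 'b \<Rightarrow> 'k) set"
  where "bilinear_relations K M N =
    (let F = free_module K (carrier M \<times> carrier N); g = (\<lambda>a b. free_gen K (a, b)) in
      {g (a \<oplus>\<^bsub>M\<^esub> a') b \<ominus>\<^bsub>F\<^esub> (g a b \<oplus>\<^bsub>F\<^esub> g a' b) | a a' b.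
         a \<in> carrier M \<and> a' \<in> carrier M \<and> b \<in> carrier N} \<union>
      {g a (b \<oplus>\<^bsub>N\<^esub> b') \<ominus>\<^bsub>F\<^esub> (g a b \<oplus>\<^bsub>F\<^esub> g a b') | a b b'.
         a \<in> carrier M \<and> b \<in> carrier N \<and> b' \<in> carrier N} \<union>
      {g (c \<odot>\<^bsub>M\<^esub> a) b \<ominus>\<^bsub>F\<^esub> c \<odot>\<^bsub>F\<^esub> g a b | c a b.
         c \<in> carrier K \<and> a \<in> carrier M \<and> b \<in> carrier N} \<union>
      {g a (c \<odot>\<^bsub>N\<^esub> b) \<ominus>\<^bsub>F\<^esub> c \<odot>\<^bsub>F\<^esub> g a b | c a b.
         c \<in> carrier K \<and> a \<in> carrier M \<and> b \<in> carrier N})"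

definition tensor_null ::
    "('k, 'm) ring_scheme \<Rightarrow> ('k, 'a, 'p) module_scheme \<Rightarrow> ('k, 'b, 'q) module_scheme \<Rightarrow> ('a \<times> 'b \<Rightarrow> 'k) set"
  where "tensor_null K M N =
    submodule_generated K (free_module K (carrier M \<times> carrier N)) (bilinear_relations K M N)"

definition tensor ::
    "('k, 'm) ring_scheme \<Rightarrow> ('k, 'a, 'p) module_scheme \<Rightarrow> ('k, 'b, 'q) module_scheme \<Rightarrow>
      ('k, ('a \<times> 'b \<Rightarrow> 'k) set) module"
  where "tensor K M N =
    quotient_module (free_module K (carrier M \<times> carrier N)) (tensor_null K M N)"

definition pure_tensor ::
    "('k, 'm) ring_scheme \<Rightarrow> ('k, 'a, 'p) module_scheme \<Rightarrow> ('k, 'b, 'q) module_scheme \<Rightarrow>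
      'a \<Rightarrow> 'b \<Rightarrow> ('a \<times> 'b \<Rightarrow> 'k) set"
  where "pure_tensor K M N a b =
    tensor_null K M N +>\<^bsub>free_module K (carrier M \<times> carrier N)\<^esub> free_gen K (a, b)"

text \<open>For bilinear \<open>\<phi>\<close>, this is the linear map on the tensor product sending each pure tensor
  \<open>a \<otimes> b\<close> to \<open>\<phi> a b\<close>: the value on a coset is computed from any representative
  \<open>\<Sum> c (a, b)\<close> as \<open>\<Sum> c \<phi> a b\<close>, and bilinearity makes the choice irrelevant. All uses below are
  for bilinear \<open>\<phi>\<close>.\<close>

definition tensor_lift ::
    "('k, 'm) ring_scheme \<Rightarrow> ('k, 'c, 'r) module_scheme \<Rightarrow> ('a \<Rightarrow> 'b \<Rightarrow> 'c) \<Rightarrow>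
      ('a \<times> 'b \<Rightarrow> 'k) set \<Rightarrow> 'c"
  where "tensor_lift K P \<phi> X =
    (let f = (SOME f. f \<in> X) in \<Oplus>\<^bsub>P\<^esub>s\<in>{s. f s \<noteq> \<zero>\<^bsub>K\<^esub>}. f s \<odot>\<^bsub>P\<^esub> \<phi> (fst s) (snd s))"

text \<open>\<open>tensor_map K M N f g\<close> is \<open>f \<otimes> g\<close>, with values in the tensor product of \<open>M\<close> and \<open>N\<close>.\<close>

definition tensor_map ::
    "('k, 'm) ring_scheme \<Rightarrow> ('k, 'c, 'p) module_scheme \<Rightarrow> ('k, 'd, 'q) module_scheme \<Rightarrow>
      ('a \<Rightarrow> 'c) \<Rightarrow> ('b \<Rightarrow> 'd) \<Rightarrow> ('a \<times> 'b \<Rightarrow> 'k) set \<Rightarrow> ('c \<times> 'd \<Rightarrow> 'k) set"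
  where "tensor_map K M N f g =
    tensor_lift K (tensor K M N) (\<lambda>a b. pure_tensor K M N (f a) (g b))"

text \<open>The canonical isomorphisms between \<open>(A \<otimes> A) \<otimes> A\<close> and \<open>A \<otimes> (A \<otimes> A)\<close>, which are usually
  suppressed when one writes the threefold tensor power of \<open>A\<close>.\<close>

definition assoc_right ::
    "('k, 'm) ring_scheme \<Rightarrow> ('k, 'a, 'p) module_scheme \<Rightarrow>
      (('a \<times> 'a \<Rightarrow> 'k) set \<times> 'a \<Rightarrow> 'k) set \<Rightarrow> ('a \<times> ('a \<times> 'a \<Rightarrow> 'k) set \<Rightarrow> 'k) set"
  where "assoc_right K A =
    (let A2 = tensor K A A in
      tensor_lift K (tensor K A A2)
        (\<lambda>t c. tensor_lift K (tensor K A A2)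
          (\<lambda>a b. pure_tensor K A A2 a (pure_tensor K A A b c)) t))"

definition assoc_left ::
    "('k, 'm) ring_scheme \<Rightarrow> ('k, 'a, 'p) module_scheme \<Rightarrow>
      ('a \<times> ('a \<times> 'a \<Rightarrow> 'k) set \<Rightarrow> 'k) set \<Rightarrow> (('a \<times> 'a \<Rightarrow> 'k) set \<times> 'a \<Rightarrow> 'k) set"
  where "assoc_left K A =
    (let A2 = tensor K A A in
      tensor_lift K (tensor K A2 A)
        (\<lambda>a t. tensor_lift K (tensor K A2 A)
          (\<lambda>b c. pure_tensor K A2 A (pure_tensor K A A a b) c) t))"

section \<open>Infinitesimal (Hom-)bialgebras\<close>

definition algebra_morphism ::
    "('k, 'm) ring_scheme \<Rightarrow> ('k, 'a, 'p) module_scheme \<Rightarrow> (('a \<times> 'a \<Rightarrow> 'k) set \<Rightarrow> 'a) \<Rightarrow>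
      ('k, 'b, 'q) module_scheme \<Rightarrow> (('b \<times> 'b \<Rightarrow> 'k) set \<Rightarrow> 'b) \<Rightarrow> ('a \<Rightarrow> 'b) \<Rightarrow> bool"
  where "algebra_morphism K A \<mu> B \<nu> f \<longleftrightarrow>
    f \<in> linear_maps K A B \<and>
    (\<forall>t\<in>carrier (tensor K A A). f (\<mu> t) = \<nu> (tensor_map K B B f f t))"

locale eps_hom_bialgebra = vector_space_char_0 K A
  for K :: "('k, 'm) ring_scheme" and A :: "('k, 'a, 'p) module_scheme"
    and \<mu> :: "('a \<times> 'a \<Rightarrow> 'k) set \<Rightarrow> 'a" and \<Delta> :: "'a \<Rightarrow> ('a \<times> 'a \<Rightarrow> 'k) set"
    and \<alpha> :: "'a \<Rightarrow> 'a" +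
  assumes mult_linear: "\<mu> \<in> linear_maps K (tensor K A A) A"
    and comult_linear: "\<Delta> \<in> linear_maps K A (tensor K A A)"
    and twist_linear: "\<alpha> \<in> linear_maps K A A"
    and twist_mult: "\<And>t. t \<in> carrier (tensor K A A) \<Longrightarrow> \<alpha> (\<mu> t) = \<mu> (tensor_map K A A \<alpha> \<alpha> t)"
    and hom_assoc: "\<And>t. t \<in> carrier (tensor K A (tensor K A A)) \<Longrightarrow>
      \<mu> (tensor_map K A A \<alpha> \<mu> t) = \<mu> (tensor_map K A A \<mu> \<alpha> (assoc_left K A t))"
    and twist_comult: "\<And>a. a \<in> carrier A \<Longrightarrow> tensor_map K A A \<alpha> \<alpha> (\<Delta> a) = \<Delta> (\<alpha> a)"
    and hom_coassoc: "\<And>a. a \<in> carrier A \<Longrightarrow>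
      tensor_map K A (tensor K A A) \<alpha> \<Delta> (\<Delta> a) =
      assoc_right K A (tensor_map K (tensor K A A) A \<Delta> \<alpha> (\<Delta> a))"
    and comult_mult: "\<And>t. t \<in> carrier (tensor K A A) \<Longrightarrow>
      \<Delta> (\<mu> t) =
      tensor_map K A A \<mu> \<alpha> (assoc_left K A (tensor_map K A (tensor K A A) \<alpha> \<Delta> t)) \<oplus>\<^bsub>tensor K A A\<^esub>
      tensor_map K A A \<alpha> \<mu> (assoc_right K A (tensor_map K (tensor K A A) A \<Delta> \<alpha> t))"

text \<open>\<open>hom_bracket K A \<mu> \<alpha> a r\<close> is \<open>[a, r]\<^sub>*\<close>.\<close>

definition hom_bracket ::
    "('k, 'm) ring_scheme \<Rightarrow> ('k, 'a, 'p) module_scheme \<Rightarrow> (('a \<times> 'a \<Rightarrow> 'k) set \<Rightarrow> 'a) \<Rightarrow>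
      ('a \<Rightarrow> 'a) \<Rightarrow> 'a \<Rightarrow> ('a \<times> 'a \<Rightarrow> 'k) set \<Rightarrow> ('a \<times> 'a \<Rightarrow> 'k) set"
  where "hom_bracket K A \<mu> \<alpha> a =
    tensor_lift K (tensor K A A)
      (\<lambda>u v. pure_tensor K A A (\<mu> (pure_tensor K A A a u)) (\<alpha> v) \<ominus>\<^bsub>tensor K A A\<^esub>
             pure_tensor K A A (\<alpha> u) (\<mu> (pure_tensor K A A v a)))"

locale coboundary_eps_hom_bialgebra = eps_hom_bialgebra K A \<mu> \<Delta> \<alpha>
  for K :: "('k, 'm) ring_scheme" and A :: "('k, 'a, 'p) module_scheme"
    and \<mu> :: "('a \<times> 'a \<Rightarrow> 'k) set \<Rightarrow> 'a" and \<Delta> :: "'a \<Rightarrow> ('a \<times> 'a \<Rightarrow> 'k) set"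
    and \<alpha> :: "'a \<Rightarrow> 'a" and r :: "('a \<times> 'a \<Rightarrow> 'k) set" +
  assumes r_closed: "r \<in> carrier (tensor K A A)"
    and r_invariant: "tensor_map K A A \<alpha> \<alpha> r = r"
    and comult_eq_bracket: "\<And>a. a \<in> carrier A \<Longrightarrow> \<Delta> a = hom_bracket K A \<mu> \<alpha> a r"

locale coboundary_eps_bialgebra = coboundary_eps_hom_bialgebra K A \<mu> \<Delta> id r
  for K :: "('k, 'm) ring_scheme" and A :: "('k, 'a, 'p) module_scheme"
    and \<mu> :: "('a \<times> 'a \<Rightarrow> 'k) set \<Rightarrow> 'a" and \<Delta> :: "'a \<Rightarrow> ('a \<times> 'a \<Rightarrow> 'k) set"
    and r :: "('a \<times> 'a \<Rightarrow> 'k) set"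

end

theory Submission
  imports Defs
begin

text \<open>Since \<open>\<alpha>\<close> is multiplicative and fixes \<open>r\<close>, it satisfies \<open>(\<alpha> \<otimes> \<alpha>) [a, r] = [\<alpha> a, r]\<close>, so
  \<open>\<alpha>\<close> is also a coalgebra morphism. Functoriality of \<open>\<otimes>\<close> then factors every twisted structure map
  through \<open>\<alpha> \<otimes> \<alpha>\<close>, for instance \<open>(\<alpha> \<otimes> \<Delta>\<^sub>\<alpha>) = (id \<otimes> \<Delta>) \<circ> (\<alpha> \<otimes> \<alpha>)\<close> and
  \<open>(\<alpha> \<otimes> \<mu>\<^sub>\<alpha>) = (\<alpha> \<otimes> \<alpha>) \<circ> (id \<otimes> \<mu>)\<close>, and each axiom reduces to the
  corresponding axiom for \<open>(A, \<mu>, \<Delta>)\<close>. What needs work is the universal property of the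
  tensor product, on which functoriality rests.\<close>

section \<open>Linear maps\<close>

lemma linear_mapsI:
  assumes "\<And>x. x \<in> carrier M \<Longrightarrow> f x \<in> carrier N"
    and "\<And>x y. x \<in> carrier M \<Longrightarrow> y \<in> carrier M \<Longrightarrow> f (x \<oplus>\<^bsub>M\<^esub> y) = f x \<oplus>\<^bsub>N\<^esub> f y"
    and "\<And>c x. c \<in> carrier K \<Longrightarrow> x \<in> carrier M \<Longrightarrow> f (c \<odot>\<^bsub>M\<^esub> x) = c \<odot>\<^bsub>N\<^esub> f x"
  shows "f \<in> linear_maps K M N"
  using assms by (auto simp: linear_maps_def)

lemma linear_map_closed: "f \<in> linear_maps K M N \<Longrightarrow> x \<in> carrier M \<Longrightarrow> f x \<in> carrier N"
  by (auto simp: linear_maps_def)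

lemma linear_map_add:
  "f \<in> linear_maps K M N \<Longrightarrow> x \<in> carrier M \<Longrightarrow> y \<in> carrier M \<Longrightarrow>
    f (x \<oplus>\<^bsub>M\<^esub> y) = f x \<oplus>\<^bsub>N\<^esub> f y"
  by (auto simp: linear_maps_def)

lemma linear_map_smult:
  "f \<in> linear_maps K M N \<Longrightarrow> c \<in> carrier K \<Longrightarrow> x \<in> carrier M \<Longrightarrow>
    f (c \<odot>\<^bsub>M\<^esub> x) = c \<odot>\<^bsub>N\<^esub> f x"
  by (auto simp: linear_maps_def)

lemma linear_map_zero:
  assumes "module K M" "module K N" "f \<in> linear_maps K M N"
  shows "f \<zero>\<^bsub>M\<^esub> = \<zero>\<^bsub>N\<^esub>"
proof -
  interpret M: module K M by fact
  interpret N: module K N by fact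
  have "f \<zero>\<^bsub>M\<^esub> = f (\<zero>\<^bsub>K\<^esub> \<odot>\<^bsub>M\<^esub> \<zero>\<^bsub>M\<^esub>)"
    by simp
  also have "\<dots> = \<zero>\<^bsub>K\<^esub> \<odot>\<^bsub>N\<^esub> f \<zero>\<^bsub>M\<^esub>"
    by (rule linear_map_smult[OF assms(3)]) auto
  also have "\<dots> = \<zero>\<^bsub>N\<^esub>"
    by (simp add: linear_map_closed[OF assms(3)])
  finally show ?thesis .
qed

lemma linear_map_minus:
  assumes "module K M" "module K N" "f \<in> linear_maps K M N"
    and "x \<in> carrier M" "y \<in> carrier M"
  shows "f (x \<ominus>\<^bsub>M\<^esub> y) = f x \<ominus>\<^bsub>N\<^esub> f y"
proof -
  interpret M: module K M by fact
  interpret N: module K N by fact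
  note cl = linear_map_closed[OF assms(3)]
  have "f (\<ominus>\<^bsub>M\<^esub> y) \<oplus>\<^bsub>N\<^esub> f y = f (\<ominus>\<^bsub>M\<^esub> y \<oplus>\<^bsub>M\<^esub> y)"
    using assms(4,5) by (simp add: linear_map_add[OF assms(3)])
  also have "\<dots> = \<zero>\<^bsub>N\<^esub>"
    using assms(5) by (simp add: M.M.l_neg linear_map_zero[OF assms(1-3)])
  finally have "f (\<ominus>\<^bsub>M\<^esub> y) = \<ominus>\<^bsub>N\<^esub> f y"
    using assms(5) cl by (metis N.M.minus_equality M.M.a_inv_closed)
  then show ?thesis
    using assms(4,5) by (simp add: M.M.minus_eq N.M.minus_eq linear_map_add[OF assms(3)])
qed

lemma linear_map_id: "id \<in> linear_maps K M M"
  by (rule linear_mapsI) auto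

lemma linear_map_comp:
  "g \<in> linear_maps K N P \<Longrightarrow> f \<in> linear_maps K M N \<Longrightarrow> g \<circ> f \<in> linear_maps K M P"
  by (rule linear_mapsI) (simp_all add: linear_map_closed linear_map_add linear_map_smult)

text \<open>Reduces vanishing on a generated submodule to vanishing on its generators: a kernel that
  contains the generators contains everything they generate.\<close>

lemma linear_map_kernel_submodule:
  assumes "module K M" "module K N" "f \<in> linear_maps K M N"
  shows "submodule {x \<in> carrier M. f x = \<zero>\<^bsub>N\<^esub>} K M"
proof -
  interpret M: module K M by fact
  interpret N: module K N by fact
  show ?thesis
  proof (rule M.submoduleI)
    fix a assume a: "a \<in> {x \<in> carrier M. f x = \<zero>\<^bsub>N\<^esub>}"
    \<comment> \<open>The negative of \<open>a\<close> is written as a difference from zero, so that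
      \<open>linear_map_minus\<close> covers it.\<close>
    have "f (\<zero>\<^bsub>M\<^esub> \<ominus>\<^bsub>M\<^esub> a) = \<zero>\<^bsub>N\<^esub>"
      using a by (simp add: linear_map_minus[OF assms] linear_map_zero[OF assms] N.M.minus_eq)
    then show "\<ominus>\<^bsub>M\<^esub> a \<in> {x \<in> carrier M. f x = \<zero>\<^bsub>N\<^esub>}"
      using a by (simp add: M.M.minus_eq)
  qed (auto simp: linear_map_zero[OF assms] linear_map_add[OF assms(3)] linear_map_smult[OF assms(3)])
qed

section \<open>Free modules\<close>

lemma free_module_carrier:
  "f \<in> carrier (free_module K S) \<longleftrightarrow>
    (\<forall>x. f x \<in> carrier K) \<and> (\<forall>x. x \<notin> S \<longrightarrow> f x = \<zero>\<^bsub>K\<^esub>) \<and> finite {x. f x \<noteq> \<zero>\<^bsub>K\<^esub>}"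
  by (simp add: free_module_def)

lemma free_module_ops:
  "\<zero>\<^bsub>free_module K S\<^esub> = (\<lambda>x. \<zero>\<^bsub>K\<^esub>)"
  "f \<oplus>\<^bsub>free_module K S\<^esub> g = (\<lambda>x. f x \<oplus>\<^bsub>K\<^esub> g x)"
  "c \<odot>\<^bsub>free_module K S\<^esub> f = (\<lambda>x. c \<otimes>\<^bsub>K\<^esub> f x)"
  by (simp_all add: free_module_def)

lemma module_free_module:
  assumes "cring K"
  shows "module K (free_module K S)"
proof -
  interpret cring K by fact
  have fin_add: "finite {x. f x \<oplus>\<^bsub>K\<^esub> g x \<noteq> \<zero>\<^bsub>K\<^esub>}"
    if "finite {x. f x \<noteq> \<zero>\<^bsub>K\<^esub>}" "finite {x. g x \<noteq> \<zero>\<^bsub>K\<^esub>}" for f g :: "'c \<Rightarrow> 'a"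
    by (rule finite_subset[OF _ finite_UnI[OF that]]) auto
  have fin_smult: "finite {x. c \<otimes>\<^bsub>K\<^esub> f x \<noteq> \<zero>\<^bsub>K\<^esub>}"
    if "finite {x. f x \<noteq> \<zero>\<^bsub>K\<^esub>}" "c \<in> carrier K" for c and f :: "'c \<Rightarrow> 'a"
    by (rule finite_subset[OF _ that(1)]) (use that(2) in auto)
  have inv: "\<exists>g\<in>carrier (free_module K S). g \<oplus>\<^bsub>free_module K S\<^esub> f = \<zero>\<^bsub>free_module K S\<^esub>"
    if "f \<in> carrier (free_module K S)" for f
  proof (rule bexI)
    \<comment> \<open>The negative is taken as the multiple by minus one, so that its finite support
      is an instance of \<open>fin_smult\<close>.\<close>
    show "(\<lambda>x. \<ominus>\<^bsub>K\<^esub> \<one>\<^bsub>K\<^esub> \<otimes>\<^bsub>K\<^esub> f x) \<in> carrier (free_module K S)"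
      using that fin_smult[of f "\<ominus>\<^bsub>K\<^esub> \<one>\<^bsub>K\<^esub>"] by (simp add: free_module_carrier)
    show "(\<lambda>x. \<ominus>\<^bsub>K\<^esub> \<one>\<^bsub>K\<^esub> \<otimes>\<^bsub>K\<^esub> f x) \<oplus>\<^bsub>free_module K S\<^esub> f = \<zero>\<^bsub>free_module K S\<^esub>"
      using that by (auto simp: free_module_carrier free_module_ops l_minus l_neg)
  qed
  have "abelian_group (free_module K S)"
    \<comment> \<open>The sixth premise of \<open>abelian_groupI\<close> asks for inverses; the
      others are checked pointwise.\<close>
    by (rule abelian_groupI, erule_tac [6] inv)
      (auto simp: free_module_carrier free_module_ops a_ac fin_add)
  then show ?thesis
    by (intro moduleI assms)
      (auto simp: free_module_carrier free_module_ops fin_smult l_distr r_distr m_assoc)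
qed

lemma free_gen_closed:
  assumes "cring K" "s \<in> S"
  shows "free_gen K s \<in> carrier (free_module K S)"
proof -
  interpret cring K by fact
  have "finite {x. free_gen K s x \<noteq> \<zero>\<^bsub>K\<^esub>}"
    by (rule finite_subset[of _ "{s}"]) (auto simp: free_gen_def)
  then show ?thesis
    using assms(2) by (auto simp: free_module_carrier free_gen_def)
qed

text \<open>A finitely supported function is a finite sum of multiples of generators; the case
  \<open>zero\<close> accounts for the empty sum.\<close>

lemma free_module_induct [consumes 2, case_names zero gen add]:
  assumes "cring K" and f: "f \<in> carrier (free_module K S)"
    and zero: "P (\<lambda>x. \<zero>\<^bsub>K\<^esub>)"
    and gen: "\<And>c s. c \<in> carrier K \<Longrightarrow> s \<in> S \<Longrightarrow> P (c \<odot>\<^bsub>free_module K S\<^esub> free_gen K s)"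
    and add: "\<And>f g. f \<in> carrier (free_module K S) \<Longrightarrow> g \<in> carrier (free_module K S) \<Longrightarrow>
      P f \<Longrightarrow> P g \<Longrightarrow> P (f \<oplus>\<^bsub>free_module K S\<^esub> g)"
  shows "P f"
proof -
  interpret cring K by fact
  interpret F: module K "free_module K S" by (rule module_free_module) fact
  \<comment> \<open>The induction runs over a finite bound \<open>T\<close> of the support and not
    over the support itself, with \<open>f\<close> arbitrary.\<close>
  have "P f" if "finite T" "f \<in> carrier (free_module K S)" "{x. f x \<noteq> \<zero>\<^bsub>K\<^esub>} \<subseteq> T" for T f
    using that
  proof (induction T arbitrary: f rule: finite_induct)
    case empty
    then have "f = (\<lambda>x. \<zero>\<^bsub>K\<^esub>)" by auto
    with zero show ?case by simp
  next
    case (insert s T)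
    show ?case
    proof (cases "s \<in> S")
      case False
      \<comment> \<open>As \<open>f\<close> vanishes outside \<open>S\<close>, the point
        \<open>s\<close> is not in its support, which therefore already lies in
        \<open>T\<close>.\<close>
      then show ?thesis
        using insert.prems by (intro insert.IH) (auto simp: free_module_carrier)
    next
      case True
      \<comment> \<open>Splitting off the term at \<open>s\<close> leaves a function supported in
        \<open>T\<close>.\<close>
      define g where "g = f(s := \<zero>\<^bsub>K\<^esub>)"
      have fin: "finite {x. g x \<noteq> \<zero>\<^bsub>K\<^esub>}"
        by (rule finite_subset[of _ "{x. f x \<noteq> \<zero>\<^bsub>K\<^esub>}"])
          (use insert.prems in \<open>auto simp: g_def free_module_carrier\<close>)
      have g: "g \<in> carrier (free_module K S)"
        using insert.prems fin by (auto simp: g_def free_module_carrier)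
      have fs: "f s \<in> carrier K"
        using insert.prems by (auto simp: free_module_carrier)
      have "f = (f s \<odot>\<^bsub>free_module K S\<^esub> free_gen K s) \<oplus>\<^bsub>free_module K S\<^esub> g"
        using insert.prems by (auto simp: free_module_ops free_gen_def g_def free_module_carrier)
      moreover have "P g"
        by (rule insert.IH[OF g]) (use insert.prems in \<open>auto simp: g_def\<close>)
      ultimately show ?thesis
        using add[OF _ g gen[OF fs True]] free_gen_closed[OF assms(1) True] fs
        by (metis F.smult_closed)
    qed
  qed
  with f show ?thesis
    by (auto simp: free_module_carrier)
qed

text \<open>The linear extension of \<open>\<phi>\<close> from the generators. For an uncurried
  \<open>\<phi>\<close> it is the sum that \<open>tensor_lift\<close> evaluates at a chosen
  representative.\<close>

definition free_lift ::
    "('k, 'm) ring_scheme \<Rightarrow> ('k, 'c, 'r) module_scheme \<Rightarrow> ('x \<Rightarrow> 'c) \<Rightarrow> ('x \<Rightarrow> 'k) \<Rightarrow> 'c"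
  where "free_lift K P \<phi> f = (\<Oplus>\<^bsub>P\<^esub>s\<in>{s. f s \<noteq> \<zero>\<^bsub>K\<^esub>}. f s \<odot>\<^bsub>P\<^esub> \<phi> s)"

text \<open>Terms outside the support are zero. This allows sums over the different supports of
  \<open>f\<close>, \<open>g\<close> and their sum to be compared over one index set.\<close>

lemma free_lift_superset:
  assumes "module K P" and \<phi>: "\<phi> \<in> S \<rightarrow> carrier P" and f: "\<And>s. f s \<in> carrier K"
    and T: "finite T" "T \<subseteq> S" "{s. f s \<noteq> \<zero>\<^bsub>K\<^esub>} \<subseteq> T"
  shows "free_lift K P \<phi> f = (\<Oplus>\<^bsub>P\<^esub>s\<in>T. f s \<odot>\<^bsub>P\<^esub> \<phi> s)"
proof -
  interpret P: module K P by fact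
  have \<phi>': "\<phi> s \<in> carrier P" if "s \<in> T" for s
    using that \<phi> T by auto
  show ?thesis
    unfolding free_lift_def
    by (rule P.M.add.finprod_mono_neutral_cong_left) (use \<phi>' f T in auto)
qed

lemma free_lift_linear:
  assumes "module K P" and \<phi>: "\<phi> \<in> S \<rightarrow> carrier P"
  shows "free_lift K P \<phi> \<in> linear_maps K (free_module K S) P"
proof -
  interpret P: module K P by fact
  interpret F: module K "free_module K S" by (rule module_free_module) (rule P.R.is_cring)
  note sup = free_lift_superset[OF assms]
  have \<phi>': "\<phi> s \<in> carrier P" if "s \<in> S" for s
    using that \<phi> by auto
  show ?thesis
  proof (rule linear_mapsI)
    fix f assume f: "f \<in> carrier (free_module K S)"
    then have "{s. f s \<noteq> \<zero>\<^bsub>K\<^esub>} \<subseteq> S" by (auto simp: free_module_carrier)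
    with f \<phi>' show "free_lift K P \<phi> f \<in> carrier P"
      unfolding free_lift_def by (intro P.M.finsum_closed) (auto simp: free_module_carrier)
  next
    fix f g assume f: "f \<in> carrier (free_module K S)" and g: "g \<in> carrier (free_module K S)"
    let ?T = "{s. f s \<noteq> \<zero>\<^bsub>K\<^esub>} \<union> {s. g s \<noteq> \<zero>\<^bsub>K\<^esub>}"
    have fgK: "f s \<in> carrier K" "g s \<in> carrier K" for s
      using f g by (auto simp: free_module_carrier)
    have T: "finite ?T" "?T \<subseteq> S"
      using f g by (auto simp: free_module_carrier)
    have \<phi>T: "\<phi> s \<in> carrier P" if "s \<in> ?T" for s
      using that T(2) \<phi>' by blast
    have "free_lift K P \<phi> (\<lambda>s. f s \<oplus>\<^bsub>K\<^esub> g s) = (\<Oplus>\<^bsub>P\<^esub>s\<in>?T. (f s \<oplus>\<^bsub>K\<^esub> g s) \<odot>\<^bsub>P\<^esub> \<phi> s)"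
      by (rule sup) (use fgK T in auto)
    also have "\<dots> = (\<Oplus>\<^bsub>P\<^esub>s\<in>?T. f s \<odot>\<^bsub>P\<^esub> \<phi> s \<oplus>\<^bsub>P\<^esub> g s \<odot>\<^bsub>P\<^esub> \<phi> s)"
      by (rule P.M.finsum_cong') (use fgK \<phi>T in \<open>auto simp: P.smult_l_distr\<close>)
    also have "\<dots> = (\<Oplus>\<^bsub>P\<^esub>s\<in>?T. f s \<odot>\<^bsub>P\<^esub> \<phi> s) \<oplus>\<^bsub>P\<^esub> (\<Oplus>\<^bsub>P\<^esub>s\<in>?T. g s \<odot>\<^bsub>P\<^esub> \<phi> s)"
      by (rule P.M.finsum_addf) (use fgK \<phi>T in auto)
    also have "(\<Oplus>\<^bsub>P\<^esub>s\<in>?T. f s \<odot>\<^bsub>P\<^esub> \<phi> s) = free_lift K P \<phi> f"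
      by (rule sup[symmetric]) (use fgK T in auto)
    also have "(\<Oplus>\<^bsub>P\<^esub>s\<in>?T. g s \<odot>\<^bsub>P\<^esub> \<phi> s) = free_lift K P \<phi> g"
      by (rule sup[symmetric]) (use fgK T in auto)
    finally show "free_lift K P \<phi> (f \<oplus>\<^bsub>free_module K S\<^esub> g) = free_lift K P \<phi> f \<oplus>\<^bsub>P\<^esub> free_lift K P \<phi> g"
      by (simp add: free_module_ops)
  next
    fix c f assume c: "c \<in> carrier K" and f: "f \<in> carrier (free_module K S)"
    \<comment> \<open>The support of the multiple lies in that of \<open>f\<close> but can be
      smaller, for instance when \<open>c\<close> is zero.\<close>
    let ?T = "{s. f s \<noteq> \<zero>\<^bsub>K\<^esub>}"
    have fK: "f s \<in> carrier K" for s
      using f by (auto simp: free_module_carrier)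
    have T: "finite ?T" "?T \<subseteq> S"
      using f by (auto simp: free_module_carrier)
    have \<phi>T: "\<phi> s \<in> carrier P" if "s \<in> ?T" for s
      using that T(2) \<phi>' by blast
    have "free_lift K P \<phi> (\<lambda>s. c \<otimes>\<^bsub>K\<^esub> f s) = (\<Oplus>\<^bsub>P\<^esub>s\<in>?T. (c \<otimes>\<^bsub>K\<^esub> f s) \<odot>\<^bsub>P\<^esub> \<phi> s)"
      by (rule sup) (use fK c T in auto)
    also have "\<dots> = (\<Oplus>\<^bsub>P\<^esub>s\<in>?T. c \<odot>\<^bsub>P\<^esub> (f s \<odot>\<^bsub>P\<^esub> \<phi> s))"
      by (rule P.M.finsum_cong') (use fK c \<phi>T in \<open>auto simp: P.smult_assoc1\<close>)
    also have "\<dots> = c \<odot>\<^bsub>P\<^esub> free_lift K P \<phi> f"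
      unfolding free_lift_def
      by (rule P.finsum_smult_ldistr[symmetric]) (use fK c T \<phi>T in auto)
    finally show "free_lift K P \<phi> (c \<odot>\<^bsub>free_module K S\<^esub> f) = c \<odot>\<^bsub>P\<^esub> free_lift K P \<phi> f"
      by (simp add: free_module_ops)
  qed
qed

lemma free_lift_gen:
  assumes "module K P" "\<phi> \<in> S \<rightarrow> carrier P" "s \<in> S"
  shows "free_lift K P \<phi> (free_gen K s) = \<phi> s"
proof -
  interpret P: module K P by fact
  have \<phi>: "\<phi> s \<in> carrier P" using assms by auto
  \<comment> \<open>Summing over \<open>{s}\<close> avoids the question whether one differs from
    zero in \<open>K\<close>, which is only a commutative ring here.\<close>
  have "free_lift K P \<phi> (free_gen K s) = (\<Oplus>\<^bsub>P\<^esub>x\<in>{s}. free_gen K s x \<odot>\<^bsub>P\<^esub> \<phi> x)"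
    by (rule free_lift_superset[OF assms(1,2)]) (use assms(3) in \<open>auto simp: free_gen_def\<close>)
  also have "\<dots> = \<phi> s"
    using \<phi> by (simp add: free_gen_def)
  finally show ?thesis .
qed

section \<open>Quotient modules\<close>

locale quotient_by_submodule = module K M + submodule H K M
  for K (structure) and M (structure) and H
begin

text \<open>A submodule is an additive subgroup of an abelian group, so the library's results on
  cosets apply to it.\<close>

sublocale HM: abelian_subgroup H M
  by (rule abelian_subgroupI3[OF additive_subgroupI])
    (rule subgroup_axioms, rule M.abelian_group_axioms)

abbreviation proj where "proj x \<equiv> H +>\<^bsub>M\<^esub> x"

lemma quotient_carrier: "carrier (quotient_module M H) = proj ` carrier M"
  by (auto simp: quotient_module_def A_RCOSETS_def')

lemma proj_eq_iff:
  assumes "x \<in> carrier M" "y \<in> carrier M"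
  shows "proj x = proj y \<longleftrightarrow> x \<ominus>\<^bsub>M\<^esub> y \<in> H"
proof -
  have "proj x = proj y \<longleftrightarrow> x \<in> proj y"
    using HM.a_rcos_self[OF assms(1)] HM.a_repr_independence'[OF _ assms(2)] by auto
  also have "\<dots> \<longleftrightarrow> x \<ominus>\<^bsub>M\<^esub> y \<in> H"
    using HM.a_rcos_module[OF assms(2,1)] by (simp add: M.minus_eq)
  finally show ?thesis .
qed

lemma proj_add:
  assumes "x \<in> carrier M" "y \<in> carrier M"
  shows "proj x \<oplus>\<^bsub>quotient_module M H\<^esub> proj y = proj (x \<oplus>\<^bsub>M\<^esub> y)"
  using HM.a_rcos_sum[OF assms] by (simp add: quotient_module_def)

text \<open>The multiple of a coset is a union over its elements. It collapses to one coset because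
  \<open>H\<close> is closed under scalars: if \<open>y\<close> and \<open>x\<close> differ by an
  element of \<open>H\<close>, so do their multiples by \<open>c\<close>.\<close>

lemma proj_smult:
  assumes "c \<in> carrier K" "x \<in> carrier M"
  shows "c \<odot>\<^bsub>quotient_module M H\<^esub> proj x = proj (c \<odot>\<^bsub>M\<^esub> x)"
proof -
  have "proj (c \<odot>\<^bsub>M\<^esub> y) = proj (c \<odot>\<^bsub>M\<^esub> x)" if y: "y \<in> proj x" for y
  proof -
    have yM: "y \<in> carrier M"
      by (rule HM.a_elemrcos_carrier[OF assms(2) y])
    have "y \<ominus>\<^bsub>M\<^esub> x \<in> H"
      using HM.a_rcos_module_imp[OF assms(2) y] by (simp add: M.minus_eq)
    then have "c \<odot>\<^bsub>M\<^esub> (y \<ominus>\<^bsub>M\<^esub> x) \<in> H"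
      by (rule smult_closed[OF assms(1)])
    then have "c \<odot>\<^bsub>M\<^esub> y \<ominus>\<^bsub>M\<^esub> c \<odot>\<^bsub>M\<^esub> x \<in> H"
      using assms yM by (simp add: M.minus_eq smult_r_distr smult_r_minus)
    then show ?thesis
      using assms yM by (simp add: proj_eq_iff)
  qed
  then have "(\<Union>y\<in>proj x. proj (c \<odot>\<^bsub>M\<^esub> y)) = (\<Union>y\<in>proj x. proj (c \<odot>\<^bsub>M\<^esub> x))"
    by (intro SUP_cong) auto
  also have "\<dots> = proj (c \<odot>\<^bsub>M\<^esub> x)"
    \<comment> \<open>The index set \<open>proj x\<close> contains \<open>x\<close>, so the union of
      a constant family over it is that constant.\<close>
    using HM.a_rcos_self[OF assms(2)] by auto
  finally show ?thesis
    by (simp add: quotient_module_def)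
qed

lemma proj_zero: "\<zero>\<^bsub>quotient_module M H\<^esub> = proj \<zero>\<^bsub>M\<^esub>"
  by (simp add: quotient_module_def HM.a_subset)

lemma module_quotient_module: "module K (quotient_module M H)"
proof (rule moduleI)
  show "cring K" by (rule R.is_cring)
  show "abelian_group (quotient_module M H)"
  proof (rule abelian_groupI)
    fix X assume "X \<in> carrier (quotient_module M H)"
    then obtain x where x: "x \<in> carrier M" "X = proj x" by (auto simp: quotient_carrier)
    then show "\<exists>Y\<in>carrier (quotient_module M H). Y \<oplus>\<^bsub>quotient_module M H\<^esub> X = \<zero>\<^bsub>quotient_module M H\<^esub>"
      by (intro bexI[of _ "proj (\<ominus>\<^bsub>M\<^esub> x)"])
        (auto simp: quotient_carrier proj_add proj_zero M.l_neg)
  qed (auto simp: quotient_carrier proj_add proj_zero M.a_ac)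
qed (auto simp: quotient_carrier proj_add proj_smult smult_l_distr smult_r_distr smult_assoc1)

lemma proj_linear: "proj \<in> linear_maps K M (quotient_module M H)"
  by (rule linear_mapsI) (auto simp: quotient_carrier proj_add proj_smult)

end

section \<open>Submodules generated by a set\<close>

lemma submodule_generated_superset: "R \<subseteq> submodule_generated K M R"
  by (auto simp: submodule_generated_def)

lemma submodule_generated_least:
  "submodule H K M \<Longrightarrow> R \<subseteq> H \<Longrightarrow> submodule_generated K M R \<subseteq> H"
  by (auto simp: submodule_generated_def)

text \<open>An intersection of submodules is a submodule. Since \<open>R\<close> lies in the
  carrier, the whole module is one of those intersected, which keeps the intersection inside the
  carrier.\<close>

lemma submodule_generated_submodule:
  assumes "module K M" "R \<subseteq> carrier M"
  shows "submodule (submodule_generated K M R) K M"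
proof -
  interpret M: module K M by fact
  note D = M.submoduleE
  show ?thesis
  proof (rule M.submoduleI)
    show "submodule_generated K M R \<subseteq> carrier M"
      by (rule submodule_generated_least[OF M.carrier_is_submodule assms(2)])
    show "\<zero>\<^bsub>M\<^esub> \<in> submodule_generated K M R"
      by (auto simp: submodule_generated_def submodule_def dest: subgroup.one_closed)
  qed (auto simp: submodule_generated_def dest: D(3-5))
qed

section \<open>Tensor products\<close>

definition bilinear_maps ::
    "('k, 'm) ring_scheme \<Rightarrow> ('k, 'a, 'p) module_scheme \<Rightarrow> ('k, 'b, 'q) module_scheme \<Rightarrow>
      ('k, 'c, 'r) module_scheme \<Rightarrow> ('a \<Rightarrow> 'b \<Rightarrow> 'c) set"
  where "bilinear_maps K M N P =
    {\<phi>. (\<forall>b\<in>carrier N. (\<lambda>a. \<phi> a b) \<in> linear_maps K M P) \<and>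
        (\<forall>a\<in>carrier M. \<phi> a \<in> linear_maps K N P)}"

lemma bilinear_mapsI:
  assumes "\<And>b. b \<in> carrier N \<Longrightarrow> (\<lambda>a. \<phi> a b) \<in> linear_maps K M P"
    and "\<And>a. a \<in> carrier M \<Longrightarrow> (\<lambda>b. \<phi> a b) \<in> linear_maps K N P"
  shows "\<phi> \<in> bilinear_maps K M N P"
  using assms by (auto simp: bilinear_maps_def)

lemma bilinear_map_left:
  "\<phi> \<in> bilinear_maps K M N P \<Longrightarrow> b \<in> carrier N \<Longrightarrow> (\<lambda>a. \<phi> a b) \<in> linear_maps K M P"
  by (auto simp: bilinear_maps_def)

lemma bilinear_map_right:
  "\<phi> \<in> bilinear_maps K M N P \<Longrightarrow> a \<in> carrier M \<Longrightarrow> (\<lambda>b. \<phi> a b) \<in> linear_maps K N P"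
  by (auto simp: bilinear_maps_def)

lemma bilinear_map_closed:
  "\<phi> \<in> bilinear_maps K M N P \<Longrightarrow> a \<in> carrier M \<Longrightarrow> b \<in> carrier N \<Longrightarrow> \<phi> a b \<in> carrier P"
  by (rule linear_map_closed[OF bilinear_map_right])

text \<open>With one argument fixed, the map is a composite of linear maps. Taking \<open>id\<close>
  for some of \<open>f\<close>, \<open>g\<close>, \<open>h\<close> gives the special cases used
  below.\<close>

lemma bilinear_map_comp:
  assumes "\<phi> \<in> bilinear_maps K M' N' P" "f \<in> linear_maps K M M'" "g \<in> linear_maps K N N'"
    and "h \<in> linear_maps K P Q"
  shows "(\<lambda>a b. h (\<phi> (f a) (g b))) \<in> bilinear_maps K M N Q"
proof (rule bilinear_mapsI)
  fix b assume "b \<in> carrier N"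
  then show "(\<lambda>a. h (\<phi> (f a) (g b))) \<in> linear_maps K M Q"
    using linear_map_comp[OF assms(4) linear_map_comp[OF bilinear_map_left[OF assms(1)] assms(2)]]
      linear_map_closed[OF assms(3)] by (simp add: comp_def)
next
  fix a assume "a \<in> carrier M"
  then show "(\<lambda>b. h (\<phi> (f a) (g b))) \<in> linear_maps K N Q"
    using linear_map_comp[OF assms(4) linear_map_comp[OF bilinear_map_right[OF assms(1)] assms(3)]]
      linear_map_closed[OF assms(2)] by (simp add: comp_def)
qed

text \<open>The two modules are kept general so that the results can be instantiated for
  \<open>A\<close> with itself and for \<open>A\<close> with its tensor square on either
  side.\<close>

locale two_modules = M: module K M + N: module K N
  for K :: "('k, 'm) ring_scheme" and M :: "('k, 'a, 'p) module_scheme"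
    and N :: "('k, 'b, 'q) module_scheme"
begin

abbreviation F where "F \<equiv> free_module K (carrier M \<times> carrier N)"

sublocale F: module K F
  by (rule module_free_module) (rule M.R.is_cring)

lemma gen_closed:
  "a \<in> carrier M \<Longrightarrow> b \<in> carrier N \<Longrightarrow> free_gen K (a, b) \<in> carrier F"
  by (rule free_gen_closed) (auto intro: M.R.is_cring)

lemma bilinear_relations_subset: "bilinear_relations K M N \<subseteq> carrier F"
  unfolding bilinear_relations_def Let_def by (auto simp: gen_closed)

sublocale Q: quotient_by_submodule K F "tensor_null K M N"
  unfolding tensor_null_def
  by (intro quotient_by_submodule.intro F.module_axioms submodule_generated_submodule
      bilinear_relations_subset)

lemma module_tensor: "module K (tensor K M N)"
  unfolding tensor_def by (rule Q.module_quotient_module)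

sublocale T: module K "tensor K M N"
  by (rule module_tensor)

lemma proj_linear: "Q.proj \<in> linear_maps K F (tensor K M N)"
  unfolding tensor_def by (rule Q.proj_linear)

lemma bilinear_relationsI:
  "a \<in> carrier M \<Longrightarrow> a' \<in> carrier M \<Longrightarrow> b \<in> carrier N \<Longrightarrow>
    free_gen K (a \<oplus>\<^bsub>M\<^esub> a', b) \<ominus>\<^bsub>F\<^esub> (free_gen K (a, b) \<oplus>\<^bsub>F\<^esub> free_gen K (a', b)) \<in> bilinear_relations K M N"
  "a \<in> carrier M \<Longrightarrow> b \<in> carrier N \<Longrightarrow> b' \<in> carrier N \<Longrightarrow>
    free_gen K (a, b \<oplus>\<^bsub>N\<^esub> b') \<ominus>\<^bsub>F\<^esub> (free_gen K (a, b) \<oplus>\<^bsub>F\<^esub> free_gen K (a, b')) \<in> bilinear_relations K M N"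
  "c \<in> carrier K \<Longrightarrow> a \<in> carrier M \<Longrightarrow> b \<in> carrier N \<Longrightarrow>
    free_gen K (c \<odot>\<^bsub>M\<^esub> a, b) \<ominus>\<^bsub>F\<^esub> c \<odot>\<^bsub>F\<^esub> free_gen K (a, b) \<in> bilinear_relations K M N"
  "c \<in> carrier K \<Longrightarrow> a \<in> carrier M \<Longrightarrow> b \<in> carrier N \<Longrightarrow>
    free_gen K (a, c \<odot>\<^bsub>N\<^esub> b) \<ominus>\<^bsub>F\<^esub> c \<odot>\<^bsub>F\<^esub> free_gen K (a, b) \<in> bilinear_relations K M N"
  unfolding bilinear_relations_def Let_def by blast+

lemma proj_eqI:
  "x \<ominus>\<^bsub>F\<^esub> y \<in> bilinear_relations K M N \<Longrightarrow> x \<in> carrier F \<Longrightarrow> y \<in> carrier F \<Longrightarrow> Q.proj x = Q.proj y"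
  using submodule_generated_superset[of "bilinear_relations K M N" K F]
  by (simp add: Q.proj_eq_iff) (auto simp: tensor_null_def)

text \<open>The four families in \<open>bilinear_relations\<close> are the obstructions to
  additivity and homogeneity in each argument, and the projection kills them.\<close>

lemma pure_tensor_bilinear: "pure_tensor K M N \<in> bilinear_maps K M N (tensor K M N)"
proof (intro bilinear_mapsI linear_mapsI)
  fix a b assume [simp]: "a \<in> carrier M" "b \<in> carrier N"
  show "pure_tensor K M N a b \<in> carrier (tensor K M N)"
    by (simp add: pure_tensor_def gen_closed linear_map_closed[OF proj_linear])
  \<comment> \<open>Linearity in the first and in the second argument both ask for closure, hence
    the repeated goal.\<close>
  then show "pure_tensor K M N a b \<in> carrier (tensor K M N)" .
  fix c assume [simp]: "c \<in> carrier K"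
  have "Q.proj (free_gen K (c \<odot>\<^bsub>M\<^esub> a, b)) = Q.proj (c \<odot>\<^bsub>F\<^esub> free_gen K (a, b))"
    by (intro proj_eqI bilinear_relationsI) (simp_all add: gen_closed)
  then show "pure_tensor K M N (c \<odot>\<^bsub>M\<^esub> a) b = c \<odot>\<^bsub>tensor K M N\<^esub> pure_tensor K M N a b"
    by (simp add: pure_tensor_def gen_closed linear_map_smult[OF proj_linear])
  have "Q.proj (free_gen K (a, c \<odot>\<^bsub>N\<^esub> b)) = Q.proj (c \<odot>\<^bsub>F\<^esub> free_gen K (a, b))"
    by (intro proj_eqI bilinear_relationsI) (simp_all add: gen_closed)
  then show "pure_tensor K M N a (c \<odot>\<^bsub>N\<^esub> b) = c \<odot>\<^bsub>tensor K M N\<^esub> pure_tensor K M N a b"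
    by (simp add: pure_tensor_def gen_closed linear_map_smult[OF proj_linear])
next
  fix a a' b assume [simp]: "a \<in> carrier M" "a' \<in> carrier M" "b \<in> carrier N"
  have "Q.proj (free_gen K (a \<oplus>\<^bsub>M\<^esub> a', b)) = Q.proj (free_gen K (a, b) \<oplus>\<^bsub>F\<^esub> free_gen K (a', b))"
    by (intro proj_eqI bilinear_relationsI) (simp_all add: gen_closed)
  then show "pure_tensor K M N (a \<oplus>\<^bsub>M\<^esub> a') b =
      pure_tensor K M N a b \<oplus>\<^bsub>tensor K M N\<^esub> pure_tensor K M N a' b"
    by (simp add: pure_tensor_def gen_closed linear_map_add[OF proj_linear])
next
  fix a b b' assume [simp]: "a \<in> carrier M" "b \<in> carrier N" "b' \<in> carrier N"
  have "Q.proj (free_gen K (a, b \<oplus>\<^bsub>N\<^esub> b')) = Q.proj (free_gen K (a, b) \<oplus>\<^bsub>F\<^esub> free_gen K (a, b'))"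
    by (intro proj_eqI bilinear_relationsI) (simp_all add: gen_closed)
  then show "pure_tensor K M N a (b \<oplus>\<^bsub>N\<^esub> b') =
      pure_tensor K M N a b \<oplus>\<^bsub>tensor K M N\<^esub> pure_tensor K M N a b'"
    by (simp add: pure_tensor_def gen_closed linear_map_add[OF proj_linear])
qed

lemma pure_tensor_closed:
  "a \<in> carrier M \<Longrightarrow> b \<in> carrier N \<Longrightarrow> pure_tensor K M N a b \<in> carrier (tensor K M N)"
  by (rule bilinear_map_closed[OF pure_tensor_bilinear])

text \<open>Every tensor is a sum of pure ones without coefficients, as a scalar can be absorbed
  into the first factor. The zero tensor is a pure tensor as well, so it needs no case of its
  own.\<close>

lemma tensor_induct [consumes 1, case_names pure add]:
  assumes X: "X \<in> carrier (tensor K M N)"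
    and pure: "\<And>a b. a \<in> carrier M \<Longrightarrow> b \<in> carrier N \<Longrightarrow> P (pure_tensor K M N a b)"
    and add: "\<And>X Y. X \<in> carrier (tensor K M N) \<Longrightarrow> Y \<in> carrier (tensor K M N) \<Longrightarrow>
      P X \<Longrightarrow> P Y \<Longrightarrow> P (X \<oplus>\<^bsub>tensor K M N\<^esub> Y)"
  shows "P X"
proof -
  have gen_pure: "P (Q.proj (c \<odot>\<^bsub>F\<^esub> free_gen K (a, b)))"
    if "c \<in> carrier K" "a \<in> carrier M" "b \<in> carrier N" for c a b
    using that pure[of "c \<odot>\<^bsub>M\<^esub> a" b]
      linear_map_smult[OF bilinear_map_left[OF pure_tensor_bilinear], of b c a]
    by (simp add: pure_tensor_def gen_closed linear_map_smult[OF proj_linear])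
  have "P (Q.proj f)" if "f \<in> carrier F" for f
    using M.R.is_cring that
  proof (induction rule: free_module_induct)
    case zero
    have "P (Q.proj (\<zero>\<^bsub>K\<^esub> \<odot>\<^bsub>F\<^esub> free_gen K (\<zero>\<^bsub>M\<^esub>, \<zero>\<^bsub>N\<^esub>)))"
      by (rule gen_pure) auto
    also have "\<zero>\<^bsub>K\<^esub> \<odot>\<^bsub>F\<^esub> free_gen K (\<zero>\<^bsub>M\<^esub>, \<zero>\<^bsub>N\<^esub>) = \<zero>\<^bsub>F\<^esub>"
      by (rule F.smult_l_null) (simp add: gen_closed)
    finally show ?case
      by (simp add: free_module_ops)
  next
    case (gen c s)
    then show ?case using gen_pure by auto
  next
    case (add f g)
    then show ?case
      by (simp add: linear_map_add[OF proj_linear] linear_map_closed[OF proj_linear] assms(3))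
  qed
  then show ?thesis
    using X by (auto simp: tensor_def Q.quotient_carrier)
qed

text \<open>Uniqueness in the universal property: pure tensors generate the tensor product
  additively.\<close>

lemma linear_maps_tensor_eqI:
  assumes "f \<in> linear_maps K (tensor K M N) P" "g \<in> linear_maps K (tensor K M N) P"
    and "\<And>a b. a \<in> carrier M \<Longrightarrow> b \<in> carrier N \<Longrightarrow> f (pure_tensor K M N a b) = g (pure_tensor K M N a b)"
    and "X \<in> carrier (tensor K M N)"
  shows "f X = g X"
  using assms(4)
  by (induction rule: tensor_induct)
    (simp_all add: assms(3) linear_map_add[OF assms(1)] linear_map_add[OF assms(2)])

section \<open>Existence in the universal property of the tensor product\<close>

context
  fixes P :: "('k, 'c, 'r) module_scheme" and \<phi> :: "'a \<Rightarrow> 'b \<Rightarrow> 'c"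
  assumes P: "module K P" and \<phi>: "\<phi> \<in> bilinear_maps K M N P"
begin

interpretation P: module K P by (rule P)

lemma uncurried_closed: "(\<lambda>s. \<phi> (fst s) (snd s)) \<in> carrier M \<times> carrier N \<rightarrow> carrier P"
  using bilinear_map_closed[OF \<phi>] by auto

abbreviation L where "L \<equiv> free_lift K P (\<lambda>s. \<phi> (fst s) (snd s))"

lemma L_linear: "L \<in> linear_maps K F P"
  by (rule free_lift_linear[OF P uncurried_closed])

lemma L_gen: "a \<in> carrier M \<Longrightarrow> b \<in> carrier N \<Longrightarrow> L (free_gen K (a, b)) = \<phi> a b"
  by (subst free_lift_gen[OF P uncurried_closed]) auto

text \<open>Bilinearity of \<open>\<phi>\<close> makes \<open>L\<close> vanish on each defining
  relation, and the kernel of \<open>L\<close> is a submodule.\<close>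

lemma L_null:
  assumes "x \<in> tensor_null K M N"
  shows "L x = \<zero>\<^bsub>P\<^esub>"
proof -
  note L_minus = linear_map_minus[OF F.module_axioms P L_linear]
  note \<phi>_simps = linear_map_add[OF bilinear_map_left[OF \<phi>]] linear_map_add[OF bilinear_map_right[OF \<phi>]]
    linear_map_smult[OF bilinear_map_left[OF \<phi>]] linear_map_smult[OF bilinear_map_right[OF \<phi>]]
    bilinear_map_closed[OF \<phi>]
  have "bilinear_relations K M N \<subseteq> {x \<in> carrier F. L x = \<zero>\<^bsub>P\<^esub>}"
    unfolding bilinear_relations_def Let_def
    by (auto simp: gen_closed L_minus linear_map_add[OF L_linear] linear_map_smult[OF L_linear]
        L_gen \<phi>_simps P.M.minus_eq P.M.r_neg)
  then have "tensor_null K M N \<subseteq> {x \<in> carrier F. L x = \<zero>\<^bsub>P\<^esub>}"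
    unfolding tensor_null_def
    by (rule submodule_generated_least[OF linear_map_kernel_submodule[OF F.module_axioms P L_linear]])
  with assms show ?thesis by auto
qed

lemma tensor_lift_proj:
  assumes "f \<in> carrier F"
  shows "tensor_lift K P \<phi> (Q.proj f) = L f"
proof -
  \<comment> \<open>This is the representative picked inside \<open>tensor_lift\<close>. It differs
    from \<open>f\<close> by an element of \<open>tensor_null\<close>, where \<open>L\<close>
    vanishes.\<close>
  define g where "g = (SOME g. g \<in> Q.proj f)"
  have g: "g \<in> Q.proj f"
    unfolding g_def by (rule someI[where x = f]) (rule Q.HM.a_rcos_self[OF assms])
  then have gF: "g \<in> carrier F"
    using Q.HM.a_elemrcos_carrier assms by blast
  have "g \<ominus>\<^bsub>F\<^esub> f \<in> tensor_null K M N"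
    using Q.HM.a_rcos_module_imp[OF assms g] by (simp add: F.M.minus_eq)
  then have "L (g \<ominus>\<^bsub>F\<^esub> f) = \<zero>\<^bsub>P\<^esub>"
    by (rule L_null)
  then have "L g \<oplus>\<^bsub>P\<^esub> \<ominus>\<^bsub>P\<^esub> L f = \<zero>\<^bsub>P\<^esub>"
    using assms gF by (simp add: linear_map_minus[OF F.module_axioms P L_linear] P.M.minus_eq)
  then have "L g = L f"
    \<comment> \<open>Uniqueness of negatives, applied to the negative of
      \<open>L f\<close>.\<close>
    using P.M.minus_equality[of "L g" "\<ominus>\<^bsub>P\<^esub> L f"] assms gF linear_map_closed[OF L_linear] by simp
  then show ?thesis
    by (simp add: tensor_lift_def g_def[symmetric] free_lift_def)
qed

lemma tensor_lift_linear: "tensor_lift K P \<phi> \<in> linear_maps K (tensor K M N) P"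
proof (rule linear_mapsI)
  have ex: "\<exists>f\<in>carrier F. X = Q.proj f" if "X \<in> carrier (tensor K M N)" for X
    using that by (auto simp: tensor_def Q.quotient_carrier)
  fix X assume "X \<in> carrier (tensor K M N)"
  then obtain f where f: "f \<in> carrier F" "X = Q.proj f" using ex by blast
  then show "tensor_lift K P \<phi> X \<in> carrier P"
    by (simp add: tensor_lift_proj linear_map_closed[OF L_linear])
  {
    fix Y assume "Y \<in> carrier (tensor K M N)"
    then obtain g where "g \<in> carrier F" "Y = Q.proj g" using ex by blast
    with f show "tensor_lift K P \<phi> (X \<oplus>\<^bsub>tensor K M N\<^esub> Y) = tensor_lift K P \<phi> X \<oplus>\<^bsub>P\<^esub> tensor_lift K P \<phi> Y"
      by (simp add: tensor_lift_proj linear_map_add[OF proj_linear, symmetric] linear_map_add[OF L_linear])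
  }
  fix c assume "c \<in> carrier K"
  with f show "tensor_lift K P \<phi> (c \<odot>\<^bsub>tensor K M N\<^esub> X) = c \<odot>\<^bsub>P\<^esub> tensor_lift K P \<phi> X"
    by (simp add: tensor_lift_proj linear_map_smult[OF proj_linear, symmetric] linear_map_smult[OF L_linear])
qed

lemma tensor_lift_pure:
  "a \<in> carrier M \<Longrightarrow> b \<in> carrier N \<Longrightarrow> tensor_lift K P \<phi> (pure_tensor K M N a b) = \<phi> a b"
  by (simp add: pure_tensor_def tensor_lift_proj gen_closed L_gen)

end

text \<open>Bilinearity only concerns values on the carriers, so \<open>\<psi>\<close> inherits it
  from \<open>\<phi>\<close>. The two lifts are then linear maps that agree on pure tensors.\<close>

lemma tensor_lift_cong:
  assumes "module K P" "\<phi> \<in> bilinear_maps K M N P"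
    and "\<And>a b. a \<in> carrier M \<Longrightarrow> b \<in> carrier N \<Longrightarrow> \<phi> a b = \<psi> a b"
    and "X \<in> carrier (tensor K M N)"
  shows "tensor_lift K P \<phi> X = tensor_lift K P \<psi> X"
proof -
  have \<psi>: "\<psi> \<in> bilinear_maps K M N P"
  proof (intro bilinear_mapsI)
    show "(\<lambda>a. \<psi> a b) \<in> linear_maps K M P" if "b \<in> carrier N" for b
      using bilinear_map_left[OF assms(2) that] assms(3) that by (simp add: linear_maps_def Pi_iff)
    show "(\<lambda>b. \<psi> a b) \<in> linear_maps K N P" if "a \<in> carrier M" for a
      using bilinear_map_right[OF assms(2) that] assms(3) that by (simp add: linear_maps_def Pi_iff)
  qed
  show ?thesis
    by (rule linear_maps_tensor_eqI[OF tensor_lift_linear[OF assms(1,2)] tensor_lift_linear[OF assms(1) \<psi>]])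
      (simp_all add: tensor_lift_pure[OF assms(1)] assms \<psi>)
qed

text \<open>Both sides are linear in \<open>X\<close> and send a pure tensor to
  \<open>h (\<phi> a b)\<close>.\<close>

lemma linear_map_tensor_lift:
  assumes "module K P" "module K Q" "\<phi> \<in> bilinear_maps K M N P" "h \<in> linear_maps K P Q"
    and "X \<in> carrier (tensor K M N)"
  shows "h (tensor_lift K P \<phi> X) = tensor_lift K Q (\<lambda>a b. h (\<phi> a b)) X"
proof -
  have h\<phi>: "(\<lambda>a b. h (\<phi> a b)) \<in> bilinear_maps K M N Q"
    using bilinear_map_comp[OF assms(3) linear_map_id linear_map_id assms(4)] by simp
  have "(h \<circ> tensor_lift K P \<phi>) X = tensor_lift K Q (\<lambda>a b. h (\<phi> a b)) X"
    by (rule linear_maps_tensor_eqI[OF linear_map_comp[OF assms(4) tensor_lift_linear[OF assms(1,3)]]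
          tensor_lift_linear[OF assms(2) h\<phi>]])
      (simp_all add: tensor_lift_pure[OF assms(1,3)] tensor_lift_pure[OF assms(2) h\<phi>] assms(5))
  then show ?thesis by simp
qed

section \<open>Functoriality of the tensor product\<close>

lemma bilinear_map_pure_comp:
  assumes "two_modules K M' N'" "f \<in> linear_maps K M M'" "g \<in> linear_maps K N N'"
  shows "(\<lambda>a b. pure_tensor K M' N' (f a) (g b)) \<in> bilinear_maps K M N (tensor K M' N')"
  using bilinear_map_comp[OF two_modules.pure_tensor_bilinear[OF assms(1)] assms(2,3) linear_map_id]
  by simp

lemma tensor_map_linear:
  assumes "two_modules K M' N'" "f \<in> linear_maps K M M'" "g \<in> linear_maps K N N'"
  shows "tensor_map K M' N' f g \<in> linear_maps K (tensor K M N) (tensor K M' N')"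
  unfolding tensor_map_def
  by (rule tensor_lift_linear[OF two_modules.module_tensor[OF assms(1)] bilinear_map_pure_comp[OF assms]])

lemma tensor_map_pure:
  assumes "two_modules K M' N'" "f \<in> linear_maps K M M'" "g \<in> linear_maps K N N'"
    and "a \<in> carrier M" "b \<in> carrier N"
  shows "tensor_map K M' N' f g (pure_tensor K M N a b) = pure_tensor K M' N' (f a) (g b)"
  unfolding tensor_map_def
  by (rule tensor_lift_pure[OF two_modules.module_tensor[OF assms(1)] bilinear_map_pure_comp[OF assms(1-3)] assms(4,5)])

text \<open>\<open>tensor_map\<close> is itself a lift, so the outer lift can be moved inside it as
  a linear map, where it meets only pure tensors.\<close>

lemma tensor_lift_tensor_map:
  assumes "two_modules K M' N'" "f \<in> linear_maps K M M'" "g \<in> linear_maps K N N'"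
    and "module K P" "\<phi> \<in> bilinear_maps K M' N' P" "X \<in> carrier (tensor K M N)"
  shows "tensor_lift K P \<phi> (tensor_map K M' N' f g X) = tensor_lift K P (\<lambda>a b. \<phi> (f a) (g b)) X"
proof -
  interpret T': two_modules K M' N' by fact
  have "tensor_lift K P \<phi> (tensor_map K M' N' f g X) =
      tensor_lift K P (\<lambda>a b. tensor_lift K P \<phi> (pure_tensor K M' N' (f a) (g b))) X"
    unfolding tensor_map_def
    by (rule linear_map_tensor_lift[OF T'.module_tensor assms(4) bilinear_map_pure_comp[OF assms(1-3)]
          T'.tensor_lift_linear[OF assms(4,5)] assms(6)])
  also have "\<dots> = tensor_lift K P (\<lambda>a b. \<phi> (f a) (g b)) X"
    using bilinear_map_comp[OF assms(5,2,3) linear_map_id] assms(2-6)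
    by (intro tensor_lift_cong[symmetric])
      (simp_all add: T'.tensor_lift_pure linear_map_closed)
  finally show ?thesis .
qed

text \<open>The case of \<open>tensor_lift_tensor_map\<close> in which \<open>\<phi>\<close> is the
  bilinear map that defines the outer \<open>tensor_map\<close>.\<close>

lemma tensor_map_comp:
  assumes "two_modules K M' N'" "f \<in> linear_maps K M M'" "g \<in> linear_maps K N N'"
    and "two_modules K M'' N''" "f' \<in> linear_maps K M' M''" "g' \<in> linear_maps K N' N''"
    and "X \<in> carrier (tensor K M N)"
  shows "tensor_map K M'' N'' f' g' (tensor_map K M' N' f g X) = tensor_map K M'' N'' (f' \<circ> f) (g' \<circ> g) X"
proof -
  interpret T': two_modules K M' N' by fact
  show ?thesis
    using tensor_lift_tensor_map[OF assms(1-3) two_modules.module_tensor[OF assms(4)]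
        T'.bilinear_map_pure_comp[OF assms(4-6)] assms(7)]
    by (simp add: tensor_map_def)
qed

text \<open>Meant for nested lifts, where the inner one depends on an argument of the outer one.
  Linearity in that parameter holds on pure tensors by \<open>lin\<close> and extends to sums by
  induction.\<close>

lemma tensor_lift_parameter_bilinear:
  assumes "module K P" and bil: "\<And>d. d \<in> carrier D \<Longrightarrow> \<phi> d \<in> bilinear_maps K M N P"
    and lin: "\<And>a b. a \<in> carrier M \<Longrightarrow> b \<in> carrier N \<Longrightarrow> (\<lambda>d. \<phi> d a b) \<in> linear_maps K D P"
    and "module K D"
  shows "(\<lambda>d. tensor_lift K P (\<phi> d)) \<in> bilinear_maps K D (tensor K M N) P"
proof -
  interpret P: module K P by fact
  interpret D: module K D by fact
  note lift_simps = tensor_lift_pure[OF assms(1) bil] linear_map_add[OF lin] linear_map_smult[OF lin]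
    linear_map_add[OF tensor_lift_linear[OF assms(1) bil]]
    linear_map_closed[OF tensor_lift_linear[OF assms(1) bil]]
  show ?thesis
  proof (rule bilinear_mapsI, rule linear_mapsI)
    fix d assume "d \<in> carrier D"
    then show "tensor_lift K P (\<phi> d) \<in> linear_maps K (tensor K M N) P"
      by (rule tensor_lift_linear[OF assms(1) bil])
  next
    fix X d assume "X \<in> carrier (tensor K M N)" "d \<in> carrier D"
    then show "tensor_lift K P (\<phi> d) X \<in> carrier P" by (simp add: lift_simps)
  next
    fix X d e assume "X \<in> carrier (tensor K M N)" "d \<in> carrier D" "e \<in> carrier D"
    then show "tensor_lift K P (\<phi> (d \<oplus>\<^bsub>D\<^esub> e)) X = tensor_lift K P (\<phi> d) X \<oplus>\<^bsub>P\<^esub> tensor_lift K P (\<phi> e) X"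
      by (induction rule: tensor_induct) (simp_all add: lift_simps P.M.a_ac)
  next
    fix X c d assume "X \<in> carrier (tensor K M N)" "c \<in> carrier K" "d \<in> carrier D"
    then show "tensor_lift K P (\<phi> (c \<odot>\<^bsub>D\<^esub> d)) X = c \<odot>\<^bsub>P\<^esub> tensor_lift K P (\<phi> d) X"
      by (induction rule: tensor_induct) (simp_all add: lift_simps P.smult_r_distr)
  qed
qed

end

section \<open>Linearity of differences and of the associativity maps\<close>

lemma linear_map_diff:
  assumes "module K N" "f \<in> linear_maps K M N" "g \<in> linear_maps K M N"
  shows "(\<lambda>x. f x \<ominus>\<^bsub>N\<^esub> g x) \<in> linear_maps K M N"
proof -
  interpret N: module K N by fact
  note simps = linear_map_closed[OF assms(2)] linear_map_closed[OF assms(3)]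
    linear_map_add[OF assms(2)] linear_map_add[OF assms(3)]
    linear_map_smult[OF assms(2)] linear_map_smult[OF assms(3)]
  show ?thesis
    by (rule linear_mapsI)
      (simp_all add: simps N.M.minus_eq N.M.minus_add N.M.a_ac N.smult_r_distr N.smult_r_minus)
qed

lemma bilinear_map_diff:
  assumes "module K P" "\<phi> \<in> bilinear_maps K M N P" "\<psi> \<in> bilinear_maps K M N P"
  shows "(\<lambda>a b. \<phi> a b \<ominus>\<^bsub>P\<^esub> \<psi> a b) \<in> bilinear_maps K M N P"
  using assms by (intro bilinear_mapsI linear_map_diff) (auto simp: bilinear_maps_def)

text \<open>The inner lift is linear in the tensor \<open>t\<close> and depends linearly on the
  parameter \<open>a\<close>, so the outer lift is applied to a bilinear map.\<close>

lemma assoc_left_linear: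
  assumes "module K A"
  shows "assoc_left K A \<in> linear_maps K (tensor K A (tensor K A A)) (tensor K (tensor K A A) A)"
proof -
  interpret T: two_modules K A A using assms by (simp add: two_modules_def)
  interpret TL: two_modules K "tensor K A A" A using assms T.module_tensor by (simp add: two_modules_def)
  interpret TR: two_modules K A "tensor K A A" using assms T.module_tensor by (simp add: two_modules_def)
  note p = bilinear_map_left[OF T.pure_tensor_bilinear] bilinear_map_right[OF T.pure_tensor_bilinear]
  have bil: "(\<lambda>b c. pure_tensor K (tensor K A A) A (pure_tensor K A A a b) c)
      \<in> bilinear_maps K A A (tensor K (tensor K A A) A)" if "a \<in> carrier A" for a
    using T.bilinear_map_pure_comp[OF TL.two_modules_axioms p(2)[OF that] linear_map_id] by simp
  have lin: "(\<lambda>a. pure_tensor K (tensor K A A) A (pure_tensor K A A a b) c)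
      \<in> linear_maps K A (tensor K (tensor K A A) A)" if "b \<in> carrier A" "c \<in> carrier A" for b c
    using linear_map_comp[OF bilinear_map_left[OF TL.pure_tensor_bilinear that(2)] p(1)[OF that(1)]]
    by (simp add: comp_def)
  show ?thesis
    unfolding assoc_left_def Let_def
    by (intro TR.tensor_lift_linear TL.module_tensor T.tensor_lift_parameter_bilinear bil lin assms)
qed

lemma assoc_right_linear:
  assumes "module K A"
  shows "assoc_right K A \<in> linear_maps K (tensor K (tensor K A A) A) (tensor K A (tensor K A A))"
proof -
  interpret T: two_modules K A A using assms by (simp add: two_modules_def)
  interpret TL: two_modules K "tensor K A A" A using assms T.module_tensor by (simp add: two_modules_def)
  interpret TR: two_modules K A "tensor K A A" using assms T.module_tensor by (simp add: two_modules_def)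
  note p = bilinear_map_left[OF T.pure_tensor_bilinear] bilinear_map_right[OF T.pure_tensor_bilinear]
  have bil: "(\<lambda>a b. pure_tensor K A (tensor K A A) a (pure_tensor K A A b c))
      \<in> bilinear_maps K A A (tensor K A (tensor K A A))" if "c \<in> carrier A" for c
    using T.bilinear_map_pure_comp[OF TR.two_modules_axioms linear_map_id p(1)[OF that]] by simp
  have lin: "(\<lambda>c. pure_tensor K A (tensor K A A) a (pure_tensor K A A b c))
      \<in> linear_maps K A (tensor K A (tensor K A A))" if "a \<in> carrier A" "b \<in> carrier A" for a b
    using linear_map_comp[OF bilinear_map_right[OF TR.pure_tensor_bilinear that(1)] p(2)[OF that(2)]]
    by (simp add: comp_def)
  have "(\<lambda>c. tensor_lift K (tensor K A (tensor K A A))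
          (\<lambda>a b. pure_tensor K A (tensor K A A) a (pure_tensor K A A b c)))
      \<in> bilinear_maps K A (tensor K A A) (tensor K A (tensor K A A))"
    by (intro TR.module_tensor T.tensor_lift_parameter_bilinear bil lin assms)
  \<comment> \<open>Here the parameter \<open>c\<close> of the inner lift is the second argument of
    the outer one. The arguments are exchanged, and bilinearity is symmetric under this.\<close>
  then have "(\<lambda>t c. tensor_lift K (tensor K A (tensor K A A))
          (\<lambda>a b. pure_tensor K A (tensor K A A) a (pure_tensor K A A b c)) t)
      \<in> bilinear_maps K (tensor K A A) A (tensor K A (tensor K A A))"
    by (auto simp: bilinear_maps_def)
  then show ?thesis
    unfolding assoc_right_def Let_def
    by (rule TL.tensor_lift_linear[OF TR.module_tensor])
qed

section \<open>Twisting by an endomorphism\<close>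

theorem theorem3p2:
  fixes K :: "('k, 'm) ring_scheme" and A :: "('k, 'a, 'p) module_scheme"
    and \<mu> :: "('a \<times> 'a \<Rightarrow> 'k) set \<Rightarrow> 'a" and \<Delta> :: "'a \<Rightarrow> ('a \<times> 'a \<Rightarrow> 'k) set"
    and r :: "('a \<times> 'a \<Rightarrow> 'k) set" and \<alpha> :: "'a \<Rightarrow> 'a"
  assumes "coboundary_eps_bialgebra K A \<mu> \<Delta> r"
    and "algebra_morphism K A \<mu> A \<mu> \<alpha>"
    and "tensor_map K A A \<alpha> \<alpha> r = r"
  shows "coboundary_eps_hom_bialgebra K A (\<alpha> \<circ> \<mu>) (\<Delta> \<circ> \<alpha>) \<alpha> r"
proof -
  interpret B: coboundary_eps_bialgebra K A \<mu> \<Delta> r by fact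
  define A2 where "A2 = tensor K A A"
  have A: "module K A" by (rule B.module_axioms)
  interpret T: two_modules K A A using A by (simp add: two_modules_def)
  have A2: "module K A2" using T.module_tensor by (simp add: A2_def)
  interpret TL: two_modules K A2 A using A A2 by (simp add: two_modules_def)
  interpret TR: two_modules K A A2 using A A2 by (simp add: two_modules_def)
  note AA = T.two_modules_axioms and A2A = TL.two_modules_axioms and AA2 = TR.two_modules_axioms
  have \<mu>: "\<mu> \<in> linear_maps K A2 A" and \<Delta>: "\<Delta> \<in> linear_maps K A A2"
    using B.mult_linear B.comult_linear by (simp_all add: A2_def)
  have \<alpha>: "\<alpha> \<in> linear_maps K A A"
    and \<alpha>\<mu>: "\<And>t. t \<in> carrier A2 \<Longrightarrow> \<alpha> (\<mu> t) = \<mu> (tensor_map K A A \<alpha> \<alpha> t)"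
    using assms(2) by (auto simp: algebra_morphism_def A2_def)
  have \<alpha>\<mu>_lin: "\<alpha> \<circ> \<mu> \<in> linear_maps K A2 A" and \<Delta>\<alpha>_lin: "\<Delta> \<circ> \<alpha> \<in> linear_maps K A A2"
    using linear_map_comp[OF \<alpha> \<mu>] linear_map_comp[OF \<Delta> \<alpha>] by auto
  have al: "assoc_left K A \<in> linear_maps K (tensor K A A2) (tensor K A2 A)"
    and ar: "assoc_right K A \<in> linear_maps K (tensor K A2 A) (tensor K A A2)"
    using assoc_left_linear[OF A] assoc_right_linear[OF A] by (simp_all add: A2_def)

  \<comment> \<open>The bracket under \<open>\<alpha> \<otimes> \<alpha>\<close>\<close>
  define \<alpha>2 where "\<alpha>2 = tensor_map K A A \<alpha> \<alpha>"
  have \<alpha>2: "\<alpha>2 \<in> linear_maps K A2 A2"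
    unfolding \<alpha>2_def A2_def by (rule T.tensor_map_linear[OF AA \<alpha> \<alpha>])
  have rA2: "r \<in> carrier A2" using B.r_closed by (simp add: A2_def)
  \<comment> \<open>The bilinear map in \<open>u\<close> and \<open>v\<close> whose lift at
    \<open>r\<close> is the untwisted bracket of \<open>a\<close> with \<open>r\<close>.\<close>
  define \<psi> where "\<psi> a u v = pure_tensor K A A (\<mu> (pure_tensor K A A a u)) v \<ominus>\<^bsub>A2\<^esub>
      pure_tensor K A A u (\<mu> (pure_tensor K A A v a))" for a u v
  have \<psi>: "\<psi> a \<in> bilinear_maps K A A A2" if "a \<in> carrier A" for a
  proof -
    note p = bilinear_map_left[OF T.pure_tensor_bilinear that, folded A2_def]
      bilinear_map_right[OF T.pure_tensor_bilinear that, folded A2_def]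
    have "(\<lambda>u. \<mu> (pure_tensor K A A a u)) \<in> linear_maps K A A"
      and "(\<lambda>v. \<mu> (pure_tensor K A A v a)) \<in> linear_maps K A A"
      using linear_map_comp[OF \<mu> p(2)] linear_map_comp[OF \<mu> p(1)] by (simp_all add: comp_def)
    from bilinear_map_diff[OF A2 T.bilinear_map_pure_comp[OF AA this(1) linear_map_id, folded A2_def]
        T.bilinear_map_pure_comp[OF AA linear_map_id this(2), folded A2_def]]
    show ?thesis by (simp add: \<psi>_def[abs_def])
  qed
  have \<Delta>_eq: "\<Delta> a = tensor_lift K A2 (\<psi> a) r" if "a \<in> carrier A" for a
    using B.comult_eq_bracket[OF that] by (simp add: hom_bracket_def \<psi>_def[abs_def] A2_def)
  have pure2: "pure_tensor K A A x y \<in> carrier A2" if "x \<in> carrier A" "y \<in> carrier A" for x y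
    using T.pure_tensor_closed[OF that] by (simp add: A2_def)
  have \<alpha>2_pure: "\<alpha>2 (pure_tensor K A A x y) = pure_tensor K A A (\<alpha> x) (\<alpha> y)"
    if "x \<in> carrier A" "y \<in> carrier A" for x y
    unfolding \<alpha>2_def using that by (rule T.tensor_map_pure[OF AA \<alpha> \<alpha>])
  have \<alpha>\<mu>_pure: "\<alpha> (\<mu> (pure_tensor K A A x y)) = \<mu> (pure_tensor K A A (\<alpha> x) (\<alpha> y))"
    if "x \<in> carrier A" "y \<in> carrier A" for x y
    using \<alpha>\<mu>[OF pure2[OF that]] \<alpha>2_pure[OF that] by (simp add: \<alpha>2_def)
  \<comment> \<open>The right-hand side is also the expression lifted by the bracket for
    \<open>\<alpha> \<circ> \<mu>\<close> and \<open>\<alpha>\<close>. It serves both for commuting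
    with \<Delta> and for the final coboundary condition.\<close>
  have \<alpha>2_\<psi>: "\<alpha>2 (\<psi> a u v) = pure_tensor K A A (\<alpha> (\<mu> (pure_tensor K A A a u))) (\<alpha> v) \<ominus>\<^bsub>A2\<^esub>
      pure_tensor K A A (\<alpha> u) (\<alpha> (\<mu> (pure_tensor K A A v a)))"
    if "a \<in> carrier A" "u \<in> carrier A" "v \<in> carrier A" for a u v
    using that by (simp add: \<psi>_def linear_map_minus[OF A2 A2 \<alpha>2] pure2 linear_map_closed[OF \<mu>] \<alpha>2_pure)
  have \<alpha>2_\<Delta>_lift: "\<alpha>2 (\<Delta> a) = tensor_lift K A2 (\<lambda>u v. \<alpha>2 (\<psi> a u v)) r" if "a \<in> carrier A" for a
    using T.linear_map_tensor_lift[OF A2 A2 \<psi>[OF that] \<alpha>2] rA2 by (simp add: \<Delta>_eq[OF that] A2_def)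
  have \<alpha>2\<psi>_bil: "(\<lambda>u v. \<alpha>2 (\<psi> a u v)) \<in> bilinear_maps K A A A2" if "a \<in> carrier A" for a
    using bilinear_map_comp[OF \<psi>[OF that] linear_map_id linear_map_id \<alpha>2] by simp
  \<comment> \<open>Here the invariance of \<open>r\<close> enters.\<close>
  have \<alpha>2_\<Delta>: "\<alpha>2 (\<Delta> a) = \<Delta> (\<alpha> a)" if a: "a \<in> carrier A" for a
  proof -
    have \<alpha>a: "\<alpha> a \<in> carrier A" by (rule linear_map_closed[OF \<alpha> a])
    have "\<alpha>2 (\<Delta> a) = tensor_lift K A2 (\<lambda>u v. \<psi> (\<alpha> a) (\<alpha> u) (\<alpha> v)) r"
      unfolding \<alpha>2_\<Delta>_lift[OF a]
      \<comment> \<open>Multiplicativity moves \<alpha> onto \<open>a\<close>, \<open>u\<close> and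
        \<open>v\<close>. There are two passes because unfolding \<open>\<psi>\<close> at once would
        hide the left-hand side of \<open>\<alpha>2_\<psi>\<close>.\<close>
      by (rule T.tensor_lift_cong[OF A2 \<alpha>2\<psi>_bil[OF a] _ rA2[unfolded A2_def]])
        (simp only: \<alpha>2_\<psi> a \<alpha>\<mu>_pure, simp only: \<psi>_def)
    also have "\<dots> = tensor_lift K A2 (\<psi> (\<alpha> a)) (tensor_map K A A \<alpha> \<alpha> r)"
      by (rule T.tensor_lift_tensor_map[OF AA \<alpha> \<alpha> A2 \<psi>[OF \<alpha>a] rA2[unfolded A2_def], symmetric])
    also have "\<dots> = \<Delta> (\<alpha> a)"
      by (simp add: assms(3) \<Delta>_eq[OF \<alpha>a])
    finally show ?thesis .
  qed

  \<comment> \<open>Factorization of the twisted structure maps\<close>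
  have cl: "\<mu> t \<in> carrier A" "\<alpha>2 t \<in> carrier A2" if "t \<in> carrier A2" for t
    using that by (simp_all add: linear_map_closed[OF \<mu>] linear_map_closed[OF \<alpha>2])
  have cl': "\<alpha> a \<in> carrier A" "\<Delta> a \<in> carrier A2" if "a \<in> carrier A" for a
    using that by (simp_all add: linear_map_closed[OF \<alpha>] linear_map_closed[OF \<Delta>])
  \<comment> \<open>The other tensor factor is left with \<open>id\<close>, the form in which the
    axioms of \<open>B\<close> are stated.\<close>
  have split_\<mu>_right: "tensor_map K A A \<alpha> (\<alpha> \<circ> \<mu>) t = \<alpha>2 (tensor_map K A A id \<mu> t)"
    if "t \<in> carrier (tensor K A A2)" for t
    using TR.tensor_map_comp[OF AA linear_map_id \<mu> AA \<alpha> \<alpha> that] by (simp add: \<alpha>2_def)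
  have split_\<mu>_left: "tensor_map K A A (\<alpha> \<circ> \<mu>) \<alpha> t = \<alpha>2 (tensor_map K A A \<mu> id t)"
    if "t \<in> carrier (tensor K A2 A)" for t
    using TL.tensor_map_comp[OF AA \<mu> linear_map_id AA \<alpha> \<alpha> that] by (simp add: \<alpha>2_def)
  have split_\<Delta>_right: "tensor_map K A A2 \<alpha> (\<Delta> \<circ> \<alpha>) t = tensor_map K A A2 id \<Delta> (\<alpha>2 t)"
    if "t \<in> carrier A2" for t
    using T.tensor_map_comp[OF AA \<alpha> \<alpha> AA2 linear_map_id \<Delta>] that by (simp add: \<alpha>2_def A2_def)
  have split_\<Delta>_left: "tensor_map K A2 A (\<Delta> \<circ> \<alpha>) \<alpha> t = tensor_map K A2 A \<Delta> id (\<alpha>2 t)"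
    if "t \<in> carrier A2" for t
    using T.tensor_map_comp[OF AA \<alpha> \<alpha> A2A \<Delta> linear_map_id] that by (simp add: \<alpha>2_def A2_def)
  have cl_R: "tensor_map K A A2 id \<Delta> t \<in> carrier (tensor K A A2)"
    and cl_L: "tensor_map K A2 A \<Delta> id t \<in> carrier (tensor K A2 A)" if "t \<in> carrier A2" for t
    using that linear_map_closed[OF T.tensor_map_linear[OF AA2 linear_map_id \<Delta>]]
      linear_map_closed[OF T.tensor_map_linear[OF A2A \<Delta> linear_map_id]] by (simp_all add: A2_def)
  have cl_\<mu>R: "tensor_map K A A id \<mu> t \<in> carrier A2" if "t \<in> carrier (tensor K A A2)" for t
    using that linear_map_closed[OF TR.tensor_map_linear[OF AA linear_map_id \<mu>]] by (simp add: A2_def)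
  have cl_\<mu>L: "tensor_map K A A \<mu> id t \<in> carrier A2" if "t \<in> carrier (tensor K A2 A)" for t
    using that linear_map_closed[OF TL.tensor_map_linear[OF AA \<mu> linear_map_id]] by (simp add: A2_def)
  note cls = cl cl' cl_R cl_L cl_\<mu>R cl_\<mu>L linear_map_closed[OF al] linear_map_closed[OF ar]

  \<comment> \<open>Verification of the axioms\<close>
  show ?thesis
  \<comment> \<open>The vector space axioms are supplied by the interpretation
    \<open>B\<close>.\<close>
  proof unfold_locales
    show "\<alpha> \<circ> \<mu> \<in> linear_maps K (tensor K A A) A" using \<alpha>\<mu>_lin by (simp add: A2_def)
    show "\<Delta> \<circ> \<alpha> \<in> linear_maps K A (tensor K A A)" using \<Delta>\<alpha>_lin by (simp add: A2_def)
    show "\<alpha> \<in> linear_maps K A A" by (rule \<alpha>)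
    show "r \<in> carrier (tensor K A A)" by (rule B.r_closed)
    show "tensor_map K A A \<alpha> \<alpha> r = r" by fact
  next
    fix t assume "t \<in> carrier (tensor K A A)"
    then show "\<alpha> ((\<alpha> \<circ> \<mu>) t) = (\<alpha> \<circ> \<mu>) (tensor_map K A A \<alpha> \<alpha> t)"
      using \<alpha>\<mu>[of t] by (simp add: A2_def)
  next
    fix t assume t: "t \<in> carrier (tensor K A (tensor K A A))"
    then have t': "t \<in> carrier (tensor K A A2)" by (simp add: A2_def)
    \<comment> \<open>The factor \<open>\<alpha>2\<close> split off the inner map passes through
      \<mu> as a second \<alpha>. The same happens on the other side, so associativity is needed
      only under \<open>\<alpha> \<circ> \<alpha>\<close>.\<close>
    have "(\<alpha> \<circ> \<mu>) (tensor_map K A A \<alpha> (\<alpha> \<circ> \<mu>) t) = \<alpha> (\<alpha> (\<mu> (tensor_map K A A id \<mu> t)))"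
      using t' by (simp add: split_\<mu>_right cls \<alpha>\<mu>[folded \<alpha>2_def])
    also have "\<dots> = \<alpha> (\<alpha> (\<mu> (tensor_map K A A \<mu> id (assoc_left K A t))))"
      by (simp only: B.hom_assoc[OF t])
    also have "\<dots> = (\<alpha> \<circ> \<mu>) (tensor_map K A A (\<alpha> \<circ> \<mu>) \<alpha> (assoc_left K A t))"
      using t' by (simp add: split_\<mu>_left cls \<alpha>\<mu>[folded \<alpha>2_def])
    finally show "(\<alpha> \<circ> \<mu>) (tensor_map K A A \<alpha> (\<alpha> \<circ> \<mu>) t) =
        (\<alpha> \<circ> \<mu>) (tensor_map K A A (\<alpha> \<circ> \<mu>) \<alpha> (assoc_left K A t))" .
  next
    fix a assume "a \<in> carrier A"
    then show "tensor_map K A A \<alpha> \<alpha> ((\<Delta> \<circ> \<alpha>) a) = (\<Delta> \<circ> \<alpha>) (\<alpha> a)"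
      using \<alpha>2_\<Delta> by (simp add: \<alpha>2_def cls)
  next
    fix a assume "a \<in> carrier A"
    then show "tensor_map K A (tensor K A A) \<alpha> (\<Delta> \<circ> \<alpha>) ((\<Delta> \<circ> \<alpha>) a) =
        assoc_right K A (tensor_map K (tensor K A A) A (\<Delta> \<circ> \<alpha>) \<alpha> ((\<Delta> \<circ> \<alpha>) a))"
      \<comment> \<open>One \<alpha> comes from the twisted comultiplication at \<open>a\<close>;
        the other is the split-off \<open>\<alpha>2\<close>, moved through \<Delta>.\<close>
      using B.hom_coassoc[of "\<alpha> (\<alpha> a)"] unfolding A2_def[symmetric]
      by (simp add: split_\<Delta>_left split_\<Delta>_right \<alpha>2_\<Delta> cls)
  next
    fix t assume "t \<in> carrier (tensor K A A)"
    then have t: "t \<in> carrier A2" by (simp add: A2_def)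
    \<comment> \<open>One \<alpha> moves inward past \<mu> and the other outward past \<Delta>. On
      the right, the comultiplications give up the inner \<open>\<alpha>2\<close> and the
      multiplications the outer one, leaving \<open>\<alpha>2\<close> of the untwisted compatibility
      at \<open>\<alpha>2 t\<close>.\<close>
    then have "(\<Delta> \<circ> \<alpha>) ((\<alpha> \<circ> \<mu>) t) = \<alpha>2 (\<Delta> (\<mu> (\<alpha>2 t)))"
      by (simp add: \<alpha>2_\<Delta> cls \<alpha>\<mu>[folded \<alpha>2_def])
    then show "(\<Delta> \<circ> \<alpha>) ((\<alpha> \<circ> \<mu>) t) =
      tensor_map K A A (\<alpha> \<circ> \<mu>) \<alpha> (assoc_left K A (tensor_map K A (tensor K A A) \<alpha> (\<Delta> \<circ> \<alpha>) t)) \<oplus>\<^bsub>tensor K A A\<^esub>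
      tensor_map K A A \<alpha> (\<alpha> \<circ> \<mu>) (assoc_right K A (tensor_map K (tensor K A A) A (\<Delta> \<circ> \<alpha>) \<alpha> t))"
      using B.comult_mult[of "\<alpha>2 t"] t unfolding A2_def[symmetric]
      by (simp add: split_\<mu>_left split_\<mu>_right split_\<Delta>_left split_\<Delta>_right cls linear_map_add[OF \<alpha>2])
  next
    fix a assume a: "a \<in> carrier A"
    \<comment> \<open>Written with \<open>\<alpha>2\<close> outermost, the map can be pushed under
      the lift, where \<open>\<alpha>2_\<psi>\<close> yields the twisted bracket with the same
      \<open>r\<close>.\<close>
    have "(\<Delta> \<circ> \<alpha>) a = \<alpha>2 (\<Delta> a)"
      using a by (simp add: \<alpha>2_\<Delta>)
    also have "\<dots> = hom_bracket K A (\<alpha> \<circ> \<mu>) \<alpha> a r"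
      unfolding \<alpha>2_\<Delta>_lift[OF a] hom_bracket_def A2_def[symmetric]
      by (rule T.tensor_lift_cong[OF A2 \<alpha>2\<psi>_bil[OF a] _ rA2[unfolded A2_def]])
        (simp add: \<alpha>2_\<psi> a)
    finally show "(\<Delta> \<circ> \<alpha>) a = hom_bracket K A (\<alpha> \<circ> \<mu>) \<alpha> a r" .
  qed
qed

end
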